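(* For integers $n\ge1$ and $k,l\ge0$ with $k+l<n$, $$\sum_{w\in\mathsf{SW}(n,k,l)}q^{\mathsf{sminv}(w)}x_w=\sum_{\sigma\in\mathsf{SW}(1^n,k,l)}q^{\mathsf{sminv}(\sigma)}\,Q_{\mathsf{Split}(\sigma),n},$$ where $x_w=\prod_{i=1}^nx_{w_i}$.
   Context: A Smirnov word is a finite word in positive integers with no two equal adjacent letters. A segmented Smirnov word of length $n$ is a word $w=w_1\cdots w_n$ of positive integers together with a composition $(\alpha_1,\dots,\alpha_s)$ of $n$ into positive parts such that, writing $w=w^1\cdots w^s$ with $w^i$ of length $\alpha_i$, each block $w^i$ is a Smirnov word. An index is initial if it is the first position of a block. Index $i$ is an ascent (descent) if $i,i+1$ lie in the same block and $w_i<w_{i+1}$ ($w_i>w_{i+1}$). $\mathsf{SW}(n,k,l)$ is the set of segmented Smirnov words of length $n$ with exactly $k$ ascents and $l$ descents; $\mathsf{SW}(1^n,k,l)$ is the subset of those whose letters are exactly $1,\dots,n$, each once (segmented permutations). A pair $(i,j)$, $1\le i<j\le n$, is a sminversion of $w$ if $w_i>w_j$ and one of the following holds: (1) $w_j$ is the first letter of its block; (2) $w_{j-1}>w_i$; (3) $i\ne j-1$, $w_{j-1}=w_i$ and $w_{j-1}$ is the first letter of its block; (4) $i\ne j-1$ and $w_{j-2}>w_{j-1}=w_i$. $\mathsf{sminv}(w)$ is the number of sminversions. A position $i$ is thick if $i$ is initial, or $i$ is not initial and $w_{i-1}>w_i$; it is thin otherwise, i.e. if $i$ is not initial and $w_{i-1}<w_i$.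 For a segmented permutation $\sigma$ of size $n$ and a value $\sigma_i<n$, let $j$ be such that $\sigma_j=\sigma_i+1$. The value $\sigma_i$ is splitting for $\sigma$ if one of the following holds: position $i$ is thick and $j$ is thin; $i$ and $j$ are both thin and $i<j$; $i$ and $j$ are both thick and $j<i$. $\mathsf{Split}(\sigma)\subseteq[n-1]$ is the set of splitting values of $\sigma$. For $S\subseteq[n-1]$, the fundamental quasisymmetric function is $Q_{S,n}=\sum x_{v_1}x_{v_2}\cdots x_{v_n}$, summed over $1\le v_1\le v_2\le\dots\le v_n$ with $v_j<v_{j+1}$ whenever $j\in S$. *)

theory Defs
  imports "HOL-Library.Multiset" "HOL-Computational_Algebra.Polynomial"
begin

section \<open>Formal power series in infinitely many variables\<close>

text \<open>
  A monomial in the variables \<open>x\<^sub>1, x\<^sub>2, \<dots>\<close> is represented by the multiset of the indices of its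
  variables, and a formal power series by its coefficient function. The variable \<open>x\<^sub>0\<close> also exists
  in this encoding but is never used.
\<close>

type_synonym 'a mseries = "nat multiset \<Rightarrow> 'a"

definition monomial :: "nat list \<Rightarrow> 'a::zero_neq_one mseries" where
  "monomial w = (\<lambda>m. if m = mset w then 1 else 0)"

definition scale :: "'a::times \<Rightarrow> 'a mseries \<Rightarrow> 'a mseries" where
  "scale c f = (\<lambda>m. c * f m)"

text \<open>
  The sum of a possibly infinite family of series, taken coefficientwise. It is meaningful for
  families in which every monomial occurs in only finitely many members; lemmas
  \<open>locally_finite_SW\<close> and \<open>locally_finite_Q\<close> below show this for the infinite families used here.
\<close>

definition formal_sum :: "('b \<Rightarrow> 'a::comm_monoid_add mseries) \<Rightarrow> 'b set \<Rightarrow> 'a mseries" where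
  "formal_sum F A = (\<lambda>m. \<Sum>a\<in>{a \<in> A. F a m \<noteq> 0}. F a m)"

definition q :: "int poly" where
  "q = [:0, 1:]"


section \<open>Segmented Smirnov words\<close>

text \<open>
  A segmented word is a word \<open>w\<close> with a composition \<open>\<alpha>\<close> of its length. Positions are counted from
  \<open>0\<close>, as usual for lists; letters are positive.
\<close>

definition composition :: "nat \<Rightarrow> nat list \<Rightarrow> bool" where
  "composition n \<alpha> \<longleftrightarrow> (\<forall>a\<in>set \<alpha>. 0 < a) \<and> sum_list \<alpha> = n"

definition block_start :: "nat list \<Rightarrow> nat \<Rightarrow> nat" where
  "block_start \<alpha> r = sum_list (take r \<alpha>)"

definition block :: "nat list \<Rightarrow> nat list \<Rightarrow> nat \<Rightarrow> nat list" where
  "block w \<alpha> r = take (\<alpha> ! r) (drop (block_start \<alpha> r) w)"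

definition smirnov :: "nat list \<Rightarrow> bool" where
  "smirnov w \<longleftrightarrow> (\<forall>a\<in>set w. 0 < a) \<and> distinct_adj w"

definition segmented_smirnov :: "nat \<Rightarrow> nat list \<Rightarrow> nat list \<Rightarrow> bool" where
  "segmented_smirnov n w \<alpha> \<longleftrightarrow>
     length w = n \<and> composition n \<alpha> \<and> (\<forall>r<length \<alpha>. smirnov (block w \<alpha> r))"

definition initial :: "nat list \<Rightarrow> nat \<Rightarrow> bool" where
  "initial \<alpha> i \<longleftrightarrow> (\<exists>r<length \<alpha>. i = block_start \<alpha> r)"

definition same_block :: "nat list \<Rightarrow> nat \<Rightarrow> nat \<Rightarrow> bool" where
  "same_block \<alpha> i j \<longleftrightarrow>
     (\<exists>r<length \<alpha>. {i, j} \<subseteq> {block_start \<alpha> r..<block_start \<alpha> (Suc r)})"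

definition ascents :: "nat list \<Rightarrow> nat list \<Rightarrow> nat set" where
  "ascents w \<alpha> = {i. same_block \<alpha> i (Suc i) \<and> w ! i < w ! Suc i}"

definition descents :: "nat list \<Rightarrow> nat list \<Rightarrow> nat set" where
  "descents w \<alpha> = {i. same_block \<alpha> i (Suc i) \<and> w ! i > w ! Suc i}"

definition SW :: "nat \<Rightarrow> nat \<Rightarrow> nat \<Rightarrow> (nat list \<times> nat list) set" where
  "SW n k l = {(w, \<alpha>). segmented_smirnov n w \<alpha> \<and>
                 card (ascents w \<alpha>) = k \<and> card (descents w \<alpha>) = l}"

text \<open>The segmented permutations \<open>SW(1\<^sup>n, k, l)\<close>.\<close>

definition SW_perm :: "nat \<Rightarrow> nat \<Rightarrow> nat \<Rightarrow> (nat list \<times> nat list) set" where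
  "SW_perm n k l = {(w, \<alpha>) \<in> SW n k l. distinct w \<and> set w = {1..n}}"


section \<open>Sminversions\<close>

text \<open>
  The truncated subtractions below are harmless: \<open>i < j\<close> makes \<open>j - 1\<close> a position, and together
  with \<open>i \<noteq> j - 1\<close> it makes \<open>j - 2\<close> a position.
\<close>

definition sminversion :: "nat list \<Rightarrow> nat list \<Rightarrow> nat \<Rightarrow> nat \<Rightarrow> bool" where
  "sminversion w \<alpha> i j \<longleftrightarrow> i < j \<and> j < length w \<and> w ! i > w ! j \<and>
     (initial \<alpha> j \<or>
      w ! (j - 1) > w ! i \<or>
      (i \<noteq> j - 1 \<and> w ! (j - 1) = w ! i \<and> initial \<alpha> (j - 1)) \<or>
      (i \<noteq> j - 1 \<and> w ! (j - 2) > w ! (j - 1) \<and> w ! (j - 1) = w ! i))"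

definition sminv :: "nat list \<Rightarrow> nat list \<Rightarrow> nat" where
  "sminv w \<alpha> = card {(i, j). sminversion w \<alpha> i j}"


section \<open>Splitting values and fundamental quasisymmetric functions\<close>

definition thick :: "nat list \<Rightarrow> nat list \<Rightarrow> nat \<Rightarrow> bool" where
  "thick w \<alpha> i \<longleftrightarrow> initial \<alpha> i \<or> (\<not> initial \<alpha> i \<and> w ! (i - 1) > w ! i)"

definition thin :: "nat list \<Rightarrow> nat list \<Rightarrow> nat \<Rightarrow> bool" where
  "thin w \<alpha> i \<longleftrightarrow> \<not> thick w \<alpha> i"

definition Split :: "nat list \<Rightarrow> nat list \<Rightarrow> nat set" where
  "Split w \<alpha> = {w ! i | i j. i < length w \<and> w ! i < length w \<and>
                  j < length w \<and> w ! j = w ! i + 1 \<and>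
                  ((thick w \<alpha> i \<and> thin w \<alpha> j) \<or>
                   (thin w \<alpha> i \<and> thin w \<alpha> j \<and> i < j) \<or>
                   (thick w \<alpha> i \<and> thick w \<alpha> j \<and> j < i))}"

text \<open>
  Elements \<open>j\<close> of \<open>S \<subseteq> {1..n-1}\<close> are indices counted from \<open>1\<close>, so that \<open>v\<^sub>j\<close> and \<open>v\<^sub>j\<^sub>+\<^sub>1\<close> are
  \<open>v ! (j - 1)\<close> and \<open>v ! j\<close>.
\<close>

definition Q_words :: "nat set \<Rightarrow> nat \<Rightarrow> nat list set" where
  "Q_words S n = {v. length v = n \<and> (\<forall>a\<in>set v. 1 \<le> a) \<and> sorted v \<and>
                     (\<forall>j\<in>S. v ! (j - 1) < v ! j)}"

definition Q :: "nat set \<Rightarrow> nat \<Rightarrow> int poly mseries" where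
  "Q S n = formal_sum monomial (Q_words S n)"


section \<open>Well-definedness of the sums\<close>

lemma finite_words_of_content: "finite {w :: nat list. mset w = m}"
  by (rule finite_subset[OF _ finite_lists_length_eq[of "set_mset m" "size m"]]) auto

lemma finite_compositions: "finite {\<alpha>. composition n \<alpha>}"
proof (rule finite_subset[OF _ finite_lists_length_le[of "{0..n}" n]])
  have "length \<alpha> \<le> sum_list \<alpha>" if "\<forall>a\<in>set \<alpha>. 0 < a" for \<alpha> :: "nat list"
    using that by (induction \<alpha>) auto
  then show "{\<alpha>. composition n \<alpha>} \<subseteq> {xs. set xs \<subseteq> {0..n} \<and> length xs \<le> n}"
    by (auto simp: composition_def member_le_sum_list)
qed simp

lemma locally_finite_SW:
  "finite {a \<in> SW n k l. (case a of (w, \<alpha>) \<Rightarrow> scale (c w \<alpha>) (monomial w)) m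
                          \<noteq> (0 :: int poly)}"
proof (rule finite_subset)
  show "finite ({w. mset w = m} \<times> {\<alpha>. composition n \<alpha>})"
    by (intro finite_cartesian_product finite_words_of_content finite_compositions)
qed (auto simp: SW_def segmented_smirnov_def scale_def monomial_def split: if_splits)

lemma locally_finite_Q: "finite {v \<in> Q_words S n. monomial v m \<noteq> (0 :: int poly)}"
  by (rule finite_subset[OF _ finite_words_of_content[of m]])
     (auto simp: monomial_def split: if_splits)

lemma finite_SW_perm: "finite (SW_perm n k l)"
proof (rule finite_subset)
  show "finite ({w. set w \<subseteq> {1..n} \<and> length w = n} \<times> {\<alpha>. composition n \<alpha>})"
    by (intro finite_cartesian_product finite_lists_length_eq finite_compositions) simp
qed (auto simp: SW_perm_def SW_def segmented_smirnov_def)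

end

theory Submission
  imports Defs
begin

text \<open>
  Standardization: number the positions of a segmented Smirnov word by increasing letter, where
  among equal letters the thin positions come first, from right to left, and then the thick ones,
  from left to right. Since neighbours inside a block differ, this changes neither ascents and
  descents nor thickness, and it preserves every single sminversion: of two equal letters
  \<open>w\<^sub>i = w\<^sub>j\<^sub>-\<^sub>1\<close> with \<open>i < j - 1\<close>, the second gets the larger number iff position \<open>j - 1\<close> is thick,
  which is what the two exceptional clauses say; and if \<open>w\<^sub>i = w\<^sub>j\<close> with \<open>i < j\<close>, the first gets the
  larger number only if \<open>j\<close> is thin, when \<open>w\<^sub>j\<^sub>-\<^sub>1\<close> is too small for a sminversion. The words with
  standardization \<open>\<sigma>\<close> are the \<open>v\<^bsub>\<sigma>\<^sub>1\<^esub> \<dots> v\<^bsub>\<sigma>\<^sub>n\<^esub>\<close> with \<open>v\<close> weakly increasing and strictly so at the values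
  that must not be merged, namely \<open>Split(\<sigma>)\<close>.
\<close>

section \<open>Blocks and initial positions\<close>

lemma block_start_Suc: "r < length \<alpha> \<Longrightarrow> block_start \<alpha> (Suc r) = block_start \<alpha> r + \<alpha> ! r"
  by (simp add: block_start_def take_Suc_conv_app_nth)

lemma block_start_mono: "r \<le> s \<Longrightarrow> block_start \<alpha> r \<le> block_start \<alpha> s"
proof (induction rule: dec_induct)
  case (step m)
  then show ?case
    by (cases "m < length \<alpha>") (auto simp: block_start_Suc, simp add: block_start_def)
qed simp

lemma block_start_le: "composition n \<alpha> \<Longrightarrow> block_start \<alpha> r \<le> n"
  using block_start_mono[of r "max r (length \<alpha>)" \<alpha>]
  by (simp add: block_start_def composition_def)

lemma in_some_block:
  assumes "composition n \<alpha>" "i < n"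
  obtains r where "r < length \<alpha>" "block_start \<alpha> r \<le> i" "i < block_start \<alpha> (Suc r)"
proof -
  \<comment> \<open>\<open>s\<close> indexes the first start beyond \<open>i\<close>; one exists
    because the start after the last block is \<open>n\<close>. The block just before it contains
    \<open>i\<close>.\<close>
  define s where "s = (LEAST s. i < block_start \<alpha> s)"
  have len: "i < block_start \<alpha> (length \<alpha>)"
    using assms by (simp add: block_start_def composition_def)
  have s: "i < block_start \<alpha> s"
    unfolding s_def by (rule LeastI[of "\<lambda>s. i < block_start \<alpha> s", OF len])
  have "s \<le> length \<alpha>"
    unfolding s_def by (rule Least_le[of "\<lambda>s. i < block_start \<alpha> s", OF len])
  moreover obtain r where r: "s = Suc r"
    using s by (cases s) (auto simp: block_start_def)
  moreover have "block_start \<alpha> r \<le> i"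
    using not_less_Least[of r "\<lambda>s. i < block_start \<alpha> s"] r by (simp add: s_def)
  ultimately show ?thesis
    using that[of r] s by (simp add: Suc_le_eq)
qed

lemma initial_0: "composition n \<alpha> \<Longrightarrow> 0 < n \<Longrightarrow> initial \<alpha> 0"
  by (auto simp: initial_def composition_def block_start_def intro!: exI[of _ 0])

text \<open>Starts are monotone, so two neighbours are separated only if the right one is itself a
  start. This lets \<open>initial\<close> replace block indices.\<close>

lemma same_block_Suc_iff:
  assumes "composition n \<alpha>"
  shows "same_block \<alpha> i (Suc i) \<longleftrightarrow> Suc i < n \<and> \<not> initial \<alpha> (Suc i)"
proof
  assume "same_block \<alpha> i (Suc i)"
  then obtain r where r: "r < length \<alpha>" "block_start \<alpha> r \<le> i" "Suc i < block_start \<alpha> (Suc r)"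
    by (auto simp: same_block_def)
  have "Suc i \<noteq> block_start \<alpha> s" for s
    using r block_start_mono[of s r \<alpha>] block_start_mono[of "Suc r" s \<alpha>] by (cases "s \<le> r") auto
  with r(3) block_start_le[OF assms, of "Suc r"] show "Suc i < n \<and> \<not> initial \<alpha> (Suc i)"
    by (auto simp: initial_def)
next
  assume i: "Suc i < n \<and> \<not> initial \<alpha> (Suc i)"
  then obtain r where r: "r < length \<alpha>" "block_start \<alpha> r \<le> Suc i" "Suc i < block_start \<alpha> (Suc r)"
    using in_some_block[OF assms] by blast
  moreover have "block_start \<alpha> r \<noteq> Suc i"
    using i r(1) by (auto simp: initial_def)
  ultimately show "same_block \<alpha> i (Suc i)"
    by (auto simp: same_block_def intro!: exI[of _ r])
qed

text \<open>The Smirnov condition without block indices; positivity of letters is kept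
  apart.\<close>

definition block_adj_distinct :: "nat list \<Rightarrow> nat list \<Rightarrow> bool" where
  "block_adj_distinct w \<alpha> \<longleftrightarrow>
     (\<forall>i. Suc i < length w \<longrightarrow> \<not> initial \<alpha> (Suc i) \<longrightarrow> w ! i \<noteq> w ! Suc i)"

lemma block_smirnov_iff:
  assumes "composition n \<alpha>" "length w = n"
  shows "(\<forall>r<length \<alpha>. smirnov (block w \<alpha> r)) \<longleftrightarrow>
         (\<forall>a\<in>set w. 0 < a) \<and> block_adj_distinct w \<alpha>"
proof -
  have len: "length (block w \<alpha> r) = \<alpha> ! r"
    and nth: "p < \<alpha> ! r \<Longrightarrow> block w \<alpha> r ! p = w ! (block_start \<alpha> r + p)"
    if "r < length \<alpha>" for r p
    using block_start_le[OF assms(1), of "Suc r"] that assms(2)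
    by (simp_all add: block_def block_start_Suc)
  show ?thesis
  proof safe
    fix a assume sm: "\<forall>r<length \<alpha>. smirnov (block w \<alpha> r)" and "a \<in> set w"
    then obtain i where i: "i < n" "a = w ! i"
      using assms(2) by (metis in_set_conv_nth)
    then obtain r where r: "r < length \<alpha>" "block_start \<alpha> r \<le> i" "i < block_start \<alpha> (Suc r)"
      using in_some_block[OF assms(1)] by blast
    then have "a = block w \<alpha> r ! (i - block_start \<alpha> r)" "i - block_start \<alpha> r < \<alpha> ! r"
      using nth[OF r(1), of "i - block_start \<alpha> r"] i by (auto simp: block_start_Suc)
    then have "a \<in> set (block w \<alpha> r)"
      using len[OF r(1)] by simp
    then show "0 < a"
      using sm r(1) by (auto simp: smirnov_def)
  next
    assume sm: "\<forall>r<length \<alpha>. smirnov (block w \<alpha> r)"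
    show "block_adj_distinct w \<alpha>"
      unfolding block_adj_distinct_def
    proof (intro allI impI)
      fix i assume "Suc i < length w" "\<not> initial \<alpha> (Suc i)"
      then have "same_block \<alpha> i (Suc i)"
        using same_block_Suc_iff[OF assms(1)] assms(2) by simp
      then obtain r where r: "r < length \<alpha>" "block_start \<alpha> r \<le> i" "Suc i < block_start \<alpha> (Suc r)"
        by (auto simp: same_block_def)
      define p where "p = i - block_start \<alpha> r"
      have p: "i = block_start \<alpha> r + p" "Suc p < \<alpha> ! r"
        using r by (auto simp: p_def block_start_Suc)
      have "block w \<alpha> r ! p \<noteq> block w \<alpha> r ! Suc p"
        using sm r(1) p(2) len[OF r(1)] by (auto simp: smirnov_def distinct_adj_conv_nth)
      then show "w ! i \<noteq> w ! Suc i"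
        using nth[OF r(1), of p] nth[OF r(1), of "Suc p"] p by simp
    qed
  next
    fix r assume pos: "\<forall>a\<in>set w. 0 < a" and adj: "block_adj_distinct w \<alpha>" and r: "r < length \<alpha>"
    have "block w \<alpha> r ! p \<noteq> block w \<alpha> r ! Suc p" if "Suc p < \<alpha> ! r" for p
    proof -
      have "same_block \<alpha> (block_start \<alpha> r + p) (Suc (block_start \<alpha> r + p))"
        using that r by (auto simp: same_block_def block_start_Suc intro!: exI[of _ r])
      then show ?thesis
        using adj same_block_Suc_iff[OF assms(1)] assms(2) nth[OF r, of p] nth[OF r, of "Suc p"] that
        by (simp add: block_adj_distinct_def)
    qed
    moreover have "set (block w \<alpha> r) \<subseteq> set w"
      unfolding block_def by (meson order_trans set_drop_subset set_take_subset)
    ultimately show "smirnov (block w \<alpha> r)"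
      using pos len[OF r] by (auto simp: smirnov_def distinct_adj_conv_nth)
  qed
qed

text \<open>After this, blocks are never unfolded again: the composition is seen only through
  \<open>composition\<close> and \<open>initial\<close>.\<close>

lemma SW_iff:
  "(w, \<alpha>) \<in> SW n k l \<longleftrightarrow>
     length w = n \<and> composition n \<alpha> \<and> (\<forall>a\<in>set w. 0 < a) \<and> block_adj_distinct w \<alpha> \<and>
     card {i. Suc i < n \<and> \<not> initial \<alpha> (Suc i) \<and> w ! i < w ! Suc i} = k \<and>
     card {i. Suc i < n \<and> \<not> initial \<alpha> (Suc i) \<and> w ! i > w ! Suc i} = l"
proof (cases "length w = n \<and> composition n \<alpha>")
  case True
  then show ?thesis
    by (simp add: SW_def segmented_smirnov_def block_smirnov_iff[of n] ascents_def descents_def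
        same_block_Suc_iff[of n])
qed (auto simp: SW_def segmented_smirnov_def)

section \<open>Standardization\<close>

text \<open>An integer key for the order among equal letters: thin positions get negative keys,
  decreasing from left to right, and thick ones nonnegative keys, increasing. The shift by 1
  separates the two ranges, which makes the key injective.\<close>

definition tie :: "nat list \<Rightarrow> nat list \<Rightarrow> nat \<Rightarrow> int" where
  "tie w \<alpha> i = (if thick w \<alpha> i then int i else - int i - 1)"

lemma tie_less_iff:
  "tie w \<alpha> i < tie w \<alpha> j \<longleftrightarrow>
     thin w \<alpha> i \<and> thick w \<alpha> j \<or> thin w \<alpha> i \<and> thin w \<alpha> j \<and> j < i \<or> thick w \<alpha> i \<and> thick w \<alpha> j \<and> i < j"
  by (auto simp: tie_def thin_def)

lemma tie_eq_iff: "tie w \<alpha> i = tie w \<alpha> j \<longleftrightarrow> i = j"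
  by (auto simp: tie_def)

text \<open>For an earlier \<open>i\<close>, the thick key of \<open>j\<close> lies above both
  possible keys of \<open>i\<close> and the thin key below both, so the thickness of
  \<open>i\<close> does not matter.\<close>

lemma tie_less_later: "i < j \<Longrightarrow> tie w \<alpha> i < tie w \<alpha> j \<longleftrightarrow> thick w \<alpha> j"
  by (auto simp: tie_def)

lemma tie_cong_thick: "thick w \<alpha> i = thick w' \<alpha> i \<Longrightarrow> tie w \<alpha> i = tie w' \<alpha> i"
  by (simp add: tie_def)

text \<open>The key \<open>t\<close> is left arbitrary: a word built from a permutation is first
  ordered by the keys of the permutation, before its own keys are known to agree with them.\<close>

definition precedes :: "(nat \<Rightarrow> int) \<Rightarrow> nat list \<Rightarrow> nat \<Rightarrow> nat \<Rightarrow> bool" where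
  "precedes t w i j \<longleftrightarrow> w ! i < w ! j \<or> w ! i = w ! j \<and> t i < t j"

definition standardizes :: "(nat \<Rightarrow> int) \<Rightarrow> nat list \<Rightarrow> nat list \<Rightarrow> bool" where
  "standardizes t w \<sigma> \<longleftrightarrow>
     length \<sigma> = length w \<and> distinct \<sigma> \<and> set \<sigma> = {1..length w} \<and>
     (\<forall>i<length w. \<forall>j<length w. \<sigma> ! i < \<sigma> ! j \<longleftrightarrow> precedes t w i j)"

lemma standardizes_less_iff:
  "\<lbrakk>standardizes t w \<sigma>; i < length w; j < length w\<rbrakk> \<Longrightarrow> \<sigma> ! i < \<sigma> ! j \<longleftrightarrow> precedes t w i j"
  by (simp add: standardizes_def)

lemma standardizes_cong:
  assumes "standardizes t w \<sigma>" "\<And>i. i < length w \<Longrightarrow> t i = t' i"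
  shows "standardizes t' w \<sigma>"
  using assms by (simp add: standardizes_def precedes_def)

section \<open>Uniqueness and existence of standardizations\<close>

lemma perm_nth_eq_rank:
  assumes "distinct \<sigma>" "set \<sigma> = {1..length \<sigma>}" "i < length \<sigma>"
  shows "\<sigma> ! i = Suc (card {j. j < length \<sigma> \<and> \<sigma> ! j < \<sigma> ! i})"
proof -
  \<comment> \<open>The letters below \<open>\<sigma> ! i\<close> fill an interval starting at 1, so
    a permutation is determined by its comparisons; uniqueness rests on this.\<close>
  have "(!) \<sigma> ` {j. j < length \<sigma> \<and> \<sigma> ! j < \<sigma> ! i} = {a \<in> set \<sigma>. a < \<sigma> ! i}"
    by (auto simp: in_set_conv_nth)
  also have "\<dots> = {1..<\<sigma> ! i}"
    using assms(2) nth_mem[OF assms(3)] by auto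
  finally have "card {j. j < length \<sigma> \<and> \<sigma> ! j < \<sigma> ! i} = card {1..<\<sigma> ! i}"
    using card_image[of "(!) \<sigma>" "{j. j < length \<sigma> \<and> \<sigma> ! j < \<sigma> ! i}"] assms(1)
    by (simp add: inj_on_nth)
  moreover have "0 < \<sigma> ! i"
    using assms(2) nth_mem[OF assms(3)] by auto
  ultimately show ?thesis
    by simp
qed

lemma standardizes_unique:
  assumes "standardizes t w \<sigma>" "standardizes t w \<sigma>'"
  shows "\<sigma> = \<sigma>'"
proof (rule nth_equalityI)
  show "length \<sigma> = length \<sigma>'"
    using assms by (simp add: standardizes_def)
  fix i assume i: "i < length \<sigma>"
  have "{j. j < length \<sigma> \<and> \<sigma> ! j < \<sigma> ! i} = {j. j < length \<sigma>' \<and> \<sigma>' ! j < \<sigma>' ! i}"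
    using i assms by (auto simp: standardizes_def)
  then show "\<sigma> ! i = \<sigma>' ! i"
    using perm_nth_eq_rank[of \<sigma> i] perm_nth_eq_rank[of \<sigma>' i] i assms by (simp add: standardizes_def)
qed

text \<open>Ranks under \<open>precedes\<close> give the permutation; injectivity of
  \<open>t\<close> makes this order total.\<close>

lemma standardizes_exists:
  assumes "inj t"
  obtains \<sigma> where "standardizes t w \<sigma>"
proof -
  let ?n = "length w"
  let ?below = "\<lambda>i. {j. j < ?n \<and> precedes t w j i}"
  define \<sigma> where "\<sigma> = map (\<lambda>i. Suc (card (?below i))) [0..<?n]"
  have nth: "\<sigma> ! i = Suc (card (?below i))" if "i < ?n" for i
    using that by (simp add: \<sigma>_def)
  have less: "\<sigma> ! i < \<sigma> ! j" if "i < ?n" "j < ?n" "precedes t w i j" for i j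
  proof -
    \<comment> \<open>Inclusion is transitivity; it is proper because \<open>i\<close> lies in the
      second set only.\<close>
    have "?below i \<subset> ?below j"
      using that by (auto simp: precedes_def)
    then have "card (?below i) < card (?below j)"
      by (intro psubset_card_mono) auto
    then show ?thesis
      using nth that by simp
  qed
  have total: "i = j \<or> precedes t w i j \<or> precedes t w j i" for i j
    using injD[OF assms, of i j] linorder_less_linear[of "t i" "t j"] by (auto simp: precedes_def)
  have iff: "\<sigma> ! i < \<sigma> ! j \<longleftrightarrow> precedes t w i j" if "i < ?n" "j < ?n" for i j
    using less[OF that] less[OF that(2,1)] total[of i j] by auto
  have len: "length \<sigma> = ?n"
    by (simp add: \<sigma>_def)
  have dist: "distinct \<sigma>"
    unfolding distinct_conv_nth len
  proof (intro allI impI)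
    fix i j assume "i < ?n" "j < ?n" "i \<noteq> j"
    then show "\<sigma> ! i \<noteq> \<sigma> ! j"
      using less[of i j] less[of j i] total[of i j] by auto
  qed
  have "card (?below i) < ?n" if "i < ?n" for i
  proof -
    \<comment> \<open>No position precedes itself, so ranks stay within the length.\<close>
    have "?below i \<subset> {..<?n}"
      using that by (auto simp: precedes_def)
    then show ?thesis
      using psubset_card_mono[of "{..<?n}" "?below i"] by simp
  qed
  then have "set \<sigma> \<subseteq> {1..?n}"
    by (auto simp: \<sigma>_def Suc_le_eq)
  then have "set \<sigma> = {1..?n}"
    using distinct_card[OF dist] len by (intro card_subset_eq) auto
  then show ?thesis
    using that[of \<sigma>] len dist iff by (simp add: standardizes_def)
qed

section \<open>Ascents, descents and thickness under standardization\<close>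

context
  fixes w \<sigma> \<alpha> :: "nat list" and t :: "nat \<Rightarrow> int"
  assumes std: "standardizes t w \<sigma>"
    and comp: "composition (length w) \<alpha>"
    and adj: "block_adj_distinct w \<alpha>"
begin

text \<open>Neighbours inside a block carry different letters, so the key \<open>t\<close> is never
  consulted.\<close>

lemma standardizes_adjacent:
  assumes "Suc i < length w" "\<not> initial \<alpha> (Suc i)"
  shows "\<sigma> ! i < \<sigma> ! Suc i \<longleftrightarrow> w ! i < w ! Suc i" "\<sigma> ! Suc i < \<sigma> ! i \<longleftrightarrow> w ! Suc i < w ! i"
  using standardizes_less_iff[OF std, of i "Suc i"] standardizes_less_iff[OF std, of "Suc i" i]
    adj assms by (auto simp: precedes_def block_adj_distinct_def)

text \<open>Being initial depends only on \<alpha>, and elsewhere thickness is a comparison with the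
  left neighbour, which position 0 never needs because it is initial.\<close>

lemma standardizes_thick:
  assumes "i < length w"
  shows "thick \<sigma> \<alpha> i \<longleftrightarrow> thick w \<alpha> i"
proof (cases "initial \<alpha> i")
  case False
  moreover from this obtain p where "i = Suc p"
    using initial_0[OF comp] assms by (cases i) auto
  ultimately show ?thesis
    using standardizes_adjacent(2)[of p] assms by (simp add: thick_def)
qed (simp add: thick_def)

lemma standardizes_tie: "i < length w \<Longrightarrow> tie \<sigma> \<alpha> i = tie w \<alpha> i"
  by (rule tie_cong_thick) (rule standardizes_thick)

lemma standardizes_block_adj_distinct: "block_adj_distinct \<sigma> \<alpha>"
  unfolding block_adj_distinct_def
proof (intro allI impI)
  fix i assume "Suc i < length \<sigma>" and init: "\<not> initial \<alpha> (Suc i)"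
  then have i: "Suc i < length w"
    using std by (simp add: standardizes_def)
  then show "\<sigma> ! i \<noteq> \<sigma> ! Suc i"
    using standardizes_adjacent[OF i init] adj init by (auto simp: block_adj_distinct_def neq_iff)
qed

lemma standardizes_SW_iff:
  assumes "\<forall>a\<in>set w. 0 < a"
  shows "(\<sigma>, \<alpha>) \<in> SW_perm (length w) k l \<longleftrightarrow> (w, \<alpha>) \<in> SW (length w) k l"
proof -
  have "{i. Suc i < length w \<and> \<not> initial \<alpha> (Suc i) \<and> \<sigma> ! i < \<sigma> ! Suc i} =
        {i. Suc i < length w \<and> \<not> initial \<alpha> (Suc i) \<and> w ! i < w ! Suc i}"
       "{i. Suc i < length w \<and> \<not> initial \<alpha> (Suc i) \<and> \<sigma> ! i > \<sigma> ! Suc i} =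
        {i. Suc i < length w \<and> \<not> initial \<alpha> (Suc i) \<and> w ! i > w ! Suc i}"
    using standardizes_adjacent by auto
  moreover have "length \<sigma> = length w" "distinct \<sigma>" "set \<sigma> = {1..length w}" "\<forall>a\<in>set \<sigma>. 0 < a"
    using std by (auto simp: standardizes_def)
  ultimately show ?thesis
    using assms comp adj standardizes_block_adj_distinct by (simp add: SW_perm_def SW_iff)
qed

end

section \<open>Sminversions under standardization\<close>

lemma sminversion_iff:
  assumes "composition (length w) \<alpha>"
  shows "sminversion w \<alpha> i j \<longleftrightarrow> i < j \<and> j < length w \<and> w ! i > w ! j \<and>
     (initial \<alpha> j \<or> w ! (j - 1) > w ! i \<or>
      i < j - 1 \<and> w ! (j - 1) = w ! i \<and> thick w \<alpha> (j - 1))"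
proof -
  \<comment> \<open>In this form, the two exceptional clauses together say that position
    \<open>j - 1\<close> is thick.\<close>
  have "j - 2 = j - 1 - 1"
    by simp
  then show ?thesis
    by (auto simp: sminversion_def thick_def)
qed

lemma standardizes_sminversion_iff:
  assumes std: "standardizes (tie w \<alpha>) w \<sigma>"
    and comp: "composition (length w) \<alpha>" and adj: "block_adj_distinct w \<alpha>"
  shows "sminversion \<sigma> \<alpha> i j \<longleftrightarrow> sminversion w \<alpha> i j"
proof (cases "i < j \<and> j < length w")
  case True
  have len: "length \<sigma> = length w" and dist: "distinct \<sigma>"
    using std by (auto simp: standardizes_def)
  define p where "p = j - 1"
  have j: "j = Suc p" "i \<le> p" "Suc p < length w"
    using True by (auto simp: p_def)
  note less = standardizes_less_iff[OF std]
  \<comment> \<open>Distinct positions of a permutation carry distinct letters, so the equality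
    clause drops out.\<close>
  have \<sigma>: "sminversion \<sigma> \<alpha> i j \<longleftrightarrow> \<sigma> ! j < \<sigma> ! i \<and> (initial \<alpha> j \<or> \<sigma> ! i < \<sigma> ! p)"
    using sminversion_iff[of \<sigma> \<alpha> i j] comp len j nth_eq_iff_index_eq[OF dist, of i p]
    by auto
  \<comment> \<open>For \<open>i < p\<close> with equal letters,
    \<open>\<sigma> ! i < \<sigma> ! p\<close> means that \<open>p\<close> is thick, so this
    comparison absorbs the equality clause.\<close>
  have w: "sminversion w \<alpha> i j \<longleftrightarrow> w ! j < w ! i \<and> (initial \<alpha> j \<or> \<sigma> ! i < \<sigma> ! p)"
    using sminversion_iff[OF comp, of i j] j less[of i p] tie_less_later[of i p w \<alpha>]
    by (cases "i = p") (auto simp: precedes_def)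
  \<comment> \<open>Otherwise the two letters are equal and \<open>j\<close> is thin; then
    \<open>w ! p < w ! j\<close> places \<open>\<sigma> ! p\<close> below
    \<open>\<sigma> ! j\<close> and hence below \<open>\<sigma> ! i\<close>.\<close>
  have "w ! j < w ! i"
    if "\<sigma> ! j < \<sigma> ! i" and "initial \<alpha> j \<or> \<sigma> ! i < \<sigma> ! p"
  proof (rule ccontr)
    assume "\<not> w ! j < w ! i"
    with that(1) have eq: "w ! j = w ! i" and "tie w \<alpha> j < tie w \<alpha> i"
      using less[of j i] j by (auto simp: precedes_def)
    then have "\<not> thick w \<alpha> j"
      using tie_less_later[of i j w \<alpha>] True by auto
    then have "\<not> initial \<alpha> j" "w ! p < w ! j"
      using adj j by (auto simp: thick_def block_adj_distinct_def)
    then have "\<sigma> ! p < \<sigma> ! j"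
      using less[of p j] j by (simp add: precedes_def)
    with that \<open>\<not> initial \<alpha> j\<close> show False
      by simp
  qed
  moreover have "\<sigma> ! j < \<sigma> ! i" if "w ! j < w ! i"
    using that less[of j i] j by (simp add: precedes_def)
  ultimately show ?thesis
    using \<sigma> w by blast
next
  case False
  moreover have "length \<sigma> = length w"
    using std by (simp add: standardizes_def)
  ultimately show ?thesis
    by (auto simp: sminversion_def)
qed

section \<open>The fibres of standardization\<close>

text \<open>The candidate inverse of standardization. Permutation letters count from 1 and list
  positions from 0, hence the shift.\<close>

definition substitute :: "nat list \<Rightarrow> nat list \<Rightarrow> nat list" where
  "substitute v \<sigma> = map (\<lambda>s. v ! (s - 1)) \<sigma>"

lemma mset_substitute:
  assumes "distinct \<sigma>" "set \<sigma> = {1..length v}"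
  shows "mset (substitute v \<sigma>) = mset v"
proof -
  have "mset \<sigma> = mset [1..<Suc (length v)]"
    using assms set_eq_iff_mset_eq_distinct[of \<sigma> "[1..<Suc (length v)]"]
    by (simp add: atLeastLessThanSuc_atLeastAtMost del: upt_Suc)
  also have "\<dots> = image_mset Suc (mset [0..<length v])"
    by (metis One_nat_def map_Suc_upt mset_map)
  finally have "mset (substitute v \<sigma>) = mset (map ((!) v) [0..<length v])"
    by (simp add: substitute_def image_mset.compositionality comp_def)
  then show ?thesis
    by (simp add: map_nth)
qed

text \<open>The clauses of \<open>Split\<close> are those of \<open>tie_less_iff\<close>: a value
  splits when giving it and its successor the same letter would reverse their order.\<close>

lemma Split_iff_tie:
  assumes "distinct \<sigma>" "i < length \<sigma>" "j < length \<sigma>" "\<sigma> ! j = Suc (\<sigma> ! i)" "\<sigma> ! i < length \<sigma>"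
  shows "\<sigma> ! i \<in> Split \<sigma> \<alpha> \<longleftrightarrow> tie \<sigma> \<alpha> j < tie \<sigma> \<alpha> i"
proof -
  \<comment> \<open>Distinctness pins down the witnesses in the definition of
    \<open>Split\<close>.\<close>
  have "i' = i \<and> j' = j"
    if "\<sigma> ! i' = \<sigma> ! i" "\<sigma> ! j' = \<sigma> ! i' + 1" "i' < length \<sigma>" "j' < length \<sigma>" for i' j'
    using that assms(2-4) nth_eq_iff_index_eq[OF assms(1), of i' i]
      nth_eq_iff_index_eq[OF assms(1), of j' j] by simp
  then have "\<sigma> ! i \<in> Split \<sigma> \<alpha> \<longleftrightarrow>
      (thick \<sigma> \<alpha> i \<and> thin \<sigma> \<alpha> j \<or> thin \<sigma> \<alpha> i \<and> thin \<sigma> \<alpha> j \<and> i < j \<or>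
       thick \<sigma> \<alpha> i \<and> thick \<sigma> \<alpha> j \<and> j < i)"
    unfolding Split_def using assms(2-5) by (smt (verit, best) Suc_eq_plus1 mem_Collect_eq)
  then show ?thesis
    by (auto simp: tie_less_iff)
qed

lemma Split_bounds:
  assumes "set \<sigma> = {1..length \<sigma>}" "a \<in> Split \<sigma> \<alpha>"
  shows "1 \<le> a" "a < length \<sigma>"
  using assms nth_mem[of _ \<sigma>] by (auto simp: Split_def)

text \<open>Since \<open>v\<close> is sorted, it is constant on all values from
  \<open>\<sigma> ! i\<close> to \<open>\<sigma> ! j\<close>. No value before the last can then
  split, so the key grows at each step of this chain.\<close>

lemma tie_increasing_on_level:
  assumes perm: "distinct \<sigma>" "set \<sigma> = {1..length \<sigma>}" and v: "v \<in> Q_words (Split \<sigma> \<alpha>) (length \<sigma>)"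
    and ij: "i < length \<sigma>" "j < length \<sigma>" "\<sigma> ! i < \<sigma> ! j" "v ! (\<sigma> ! i - 1) = v ! (\<sigma> ! j - 1)"
  shows "tie \<sigma> \<alpha> i < tie \<sigma> \<alpha> j"
  using ij
proof (induction "\<sigma> ! j" arbitrary: j rule: less_induct)
  case less
  have "length v = length \<sigma>" "sorted v"
    using v by (auto simp: Q_words_def)
  note mono = sorted_nth_mono[OF this(2)]
  have range: "1 \<le> \<sigma> ! i" "\<sigma> ! j \<le> length \<sigma>"
    using perm(2) nth_mem less.prems by (metis atLeastAtMost_iff)+
  then have "\<sigma> ! j - 1 \<in> set \<sigma>"
    using perm(2) less.prems(3) by auto
  \<comment> \<open>\<open>h\<close> is the position of the value just below
    \<open>\<sigma> ! j\<close>; the induction peels off the top of the chain.\<close>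
  then obtain h where h: "h < length \<sigma>" "\<sigma> ! h = \<sigma> ! j - 1"
    by (metis in_set_conv_nth)
  have "\<sigma> ! i - 1 \<le> \<sigma> ! h - 1" "\<sigma> ! h - 1 \<le> \<sigma> ! j - 1" "\<sigma> ! j - 1 < length v"
    using less.prems(3) h(2) range \<open>length v = length \<sigma>\<close> by linarith+
  then have sandwich: "v ! (\<sigma> ! i - 1) = v ! (\<sigma> ! h - 1)" "v ! (\<sigma> ! h - 1) = v ! (\<sigma> ! j - 1)"
    using mono[of "\<sigma> ! i - 1" "\<sigma> ! h - 1"] mono[of "\<sigma> ! h - 1" "\<sigma> ! j - 1"] less.prems(4)
    by linarith+
  have "\<sigma> ! h \<notin> Split \<sigma> \<alpha>"
    using v sandwich(2) h(2) by (auto simp: Q_words_def)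
  then have "\<not> tie \<sigma> \<alpha> j < tie \<sigma> \<alpha> h"
    using Split_iff_tie[OF perm(1) h(1) less.prems(2), of \<alpha>] h(2) less.prems(3) range by simp
  moreover have "h \<noteq> j"
    using h less.prems by auto
  ultimately have hj: "tie \<sigma> \<alpha> h < tie \<sigma> \<alpha> j"
    using tie_eq_iff[of \<sigma> \<alpha> h j] by linarith
  show ?case
  proof (cases "\<sigma> ! i = \<sigma> ! h")
    case True
    then show ?thesis
      using hj h(1) less.prems(1) nth_eq_iff_index_eq[OF perm(1)] by simp
  next
    case False
    then have "tie \<sigma> \<alpha> i < tie \<sigma> \<alpha> h"
      using less.hyps[of h] less.prems h sandwich(1) by simp
    then show ?thesis
      using hj by simp
  qed
qed

text \<open>The comparisons are checked with the keys of \<sigma>. They show that block neighbours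
  in \<open>w\<close> differ, hence that \<open>w\<close> and \<sigma> have the same thick
  positions, and only then are the keys exchanged.\<close>

lemma substitute_standardizes:
  assumes perm: "distinct \<sigma>" "set \<sigma> = {1..length \<sigma>}" and v: "v \<in> Q_words (Split \<sigma> \<alpha>) (length \<sigma>)"
    and comp: "composition (length \<sigma>) \<alpha>"
  defines "w \<equiv> substitute v \<sigma>"
  shows "standardizes (tie w \<alpha>) w \<sigma>" "block_adj_distinct w \<alpha>"
proof -
  have len: "length w = length \<sigma>" "length v = length \<sigma>" and "sorted v"
    using v by (auto simp: Q_words_def w_def substitute_def)
  have nth: "w ! i = v ! (\<sigma> ! i - 1)" if "i < length \<sigma>" for i
    using that by (simp add: w_def substitute_def)
  have range: "1 \<le> \<sigma> ! i" "\<sigma> ! i \<le> length \<sigma>" if "i < length \<sigma>" for i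
    using perm(2) nth_mem[OF that] by auto
  have forth: "precedes (tie \<sigma> \<alpha>) w i j"
    if "i < length \<sigma>" "j < length \<sigma>" "\<sigma> ! i < \<sigma> ! j" for i j
  proof -
    have "w ! i \<le> w ! j"
      using sorted_nth_mono[OF \<open>sorted v\<close>, of "\<sigma> ! i - 1" "\<sigma> ! j - 1"] that range[OF that(1)]
        range[OF that(2)] nth len by simp
    then show ?thesis
      using tie_increasing_on_level[OF perm v that] nth that by (auto simp: precedes_def)
  qed
  have "\<sigma> ! i < \<sigma> ! j" if "i < length \<sigma>" "j < length \<sigma>" "precedes (tie \<sigma> \<alpha>) w i j" for i j
    using forth[OF that(2,1)] that nth_eq_iff_index_eq[OF perm(1) that(1,2)]
    by (cases "\<sigma> ! i" "\<sigma> ! j" rule: linorder_cases) (auto simp: precedes_def)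
  with forth have std: "standardizes (tie \<sigma> \<alpha>) w \<sigma>"
    using perm len by (auto simp: standardizes_def)
  show adj: "block_adj_distinct w \<alpha>"
    unfolding block_adj_distinct_def
  proof (intro allI impI notI)
    fix i assume i: "Suc i < length w" "\<not> initial \<alpha> (Suc i)" and eq: "w ! i = w ! Suc i"
    \<comment> \<open>Equal letters would make an ascent of \<sigma> equivalent to thickness of a
      non-initial position, which is a descent.\<close>
    have "\<sigma> ! i < \<sigma> ! Suc i \<longleftrightarrow> thick \<sigma> \<alpha> (Suc i)"
      using standardizes_less_iff[OF std, of i "Suc i"] i eq tie_less_later[of i "Suc i" \<sigma> \<alpha>]
      by (simp add: precedes_def)
    then show False
      using i len nth_eq_iff_index_eq[OF perm(1), of i "Suc i"] by (auto simp: thick_def)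
  qed
  show "standardizes (tie w \<alpha>) w \<sigma>"
    using standardizes_cong[OF std standardizes_tie[OF std _ adj]] comp len by simp
qed

section \<open>Recovering a word from its standardization\<close>

lemma standardizes_substitute_sort:
  assumes "standardizes t w \<sigma>"
  shows "substitute (sort w) \<sigma> = w"
proof -
  let ?n = "length w"
  have len: "length \<sigma> = ?n" and dist: "distinct \<sigma>" and set: "set \<sigma> = {1..?n}"
    using assms by (auto simp: standardizes_def)
  \<comment> \<open>The inverse permutation: \<open>us ! a\<close> is the position of the letter
    \<open>Suc a\<close>. Reading \<open>w\<close> along it sorts \<open>w\<close>.\<close>
  define us where "us = sort_key ((!) \<sigma>) [0..<?n]"
  have us: "length us = ?n" "set us = {..<?n}"
    by (auto simp: us_def)
  have "map ((!) \<sigma>) us = [1..<Suc ?n]"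
  proof (rule sorted_distinct_set_unique)
    have "mset (map ((!) \<sigma>) us) = mset (map ((!) \<sigma>) [0..<?n])"
      by (simp add: us_def)
    then have "mset (map ((!) \<sigma>) us) = mset \<sigma>"
      by (simp add: map_nth flip: len)
    then show "distinct (map ((!) \<sigma>) us)" "set (map ((!) \<sigma>) us) = set [1..<Suc ?n]"
      using dist set by (metis mset_eq_imp_distinct_iff,
        metis mset_eq_setD atLeastLessThanSuc_atLeastAtMost set_upt)
  qed (simp_all add: us_def del: upt_Suc)
  then have nth_eq: "map ((!) \<sigma>) us ! a = [1..<Suc ?n] ! a" for a
    by simp
  have inv: "\<sigma> ! (us ! a) = Suc a" if "a < ?n" for a
    using nth_eq[of a] that us(1) by (simp del: upt_Suc)
  have us_lt: "us ! a < ?n" if "a < ?n" for a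
    using that us nth_mem[of a us] by auto
  have "sorted (map ((!) w) us)"
    unfolding sorted_iff_nth_mono_less
  proof (intro allI impI)
    fix a b assume ab: "a < b" "b < length (map ((!) w) us)"
    then have "precedes t w (us ! a) (us ! b)"
      using standardizes_less_iff[OF assms, of "us ! a" "us ! b"] inv us_lt us(1) by simp
    then show "map ((!) w) us ! a \<le> map ((!) w) us ! b"
      using ab us(1) by (auto simp: precedes_def)
  qed
  moreover have "mset (map ((!) w) us) = mset (map ((!) w) [0..<?n])"
    by (simp add: us_def)
  ultimately have sort: "sort w = map ((!) w) us"
    by (intro properties_for_sort) (simp_all add: map_nth)
  show ?thesis
  proof (rule nth_equalityI)
    fix i assume "i < length (substitute (sort w) \<sigma>)"
    then have i: "i < ?n"
      by (simp add: substitute_def len)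
    then have range: "1 \<le> \<sigma> ! i" "\<sigma> ! i \<le> ?n"
      using set nth_mem[of i \<sigma>] len by auto
    then have "\<sigma> ! (us ! (\<sigma> ! i - 1)) = \<sigma> ! i" "us ! (\<sigma> ! i - 1) < ?n"
      using inv us_lt by simp_all
    then have "us ! (\<sigma> ! i - 1) = i"
      using i len nth_eq_iff_index_eq[OF dist] by simp
    then show "substitute (sort w) \<sigma> ! i = w ! i"
      using sort range i us(1) len by (simp add: substitute_def)
  qed (simp add: substitute_def len)
qed

text \<open>At a splitting value the key order opposes the order in \<sigma>, so the corresponding
  letters of \<open>w\<close> cannot be equal.\<close>

lemma sort_in_Q_words:
  assumes std: "standardizes (tie w \<alpha>) w \<sigma>" and comp: "composition (length w) \<alpha>"
    and adj: "block_adj_distinct w \<alpha>" and pos: "\<forall>a\<in>set w. 0 < a"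
  shows "sort w \<in> Q_words (Split \<sigma> \<alpha>) (length w)"
proof -
  have len: "length \<sigma> = length w" and dist: "distinct \<sigma>" and set: "set \<sigma> = {1..length w}"
    using std by (auto simp: standardizes_def)
  have "sort w ! (a - 1) < sort w ! a" if a: "a \<in> Split \<sigma> \<alpha>" for a
  proof -
    obtain i j where ij: "i < length \<sigma>" "j < length \<sigma>" "a = \<sigma> ! i" "\<sigma> ! j = Suc (\<sigma> ! i)"
      using a by (auto simp: Split_def)
    then have "tie w \<alpha> j < tie w \<alpha> i"
      using Split_iff_tie[OF dist ij(1,2,4)] a Split_bounds[of \<sigma> a \<alpha>] set len
        standardizes_tie[OF std comp adj] by simp
    then have "w ! i < w ! j"
      using standardizes_less_iff[OF std, of i j] ij len by (auto simp: precedes_def)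
    then have "substitute (sort w) \<sigma> ! i < substitute (sort w) \<sigma> ! j"
      using standardizes_substitute_sort[OF std] by simp
    then show ?thesis
      using ij by (simp add: substitute_def)
  qed
  then show ?thesis
    using pos by (auto simp: Q_words_def Suc_le_eq)
qed

section \<open>Comparison of coefficients at a fixed monomial\<close>

lemma Q_coeff:
  "Q S n m = (if sorted_list_of_multiset m \<in> Q_words S n then 1 else 0)"
proof -
  \<comment> \<open>A weakly increasing word is determined by its content, so at most one summand
    contributes.\<close>
  have "v = sorted_list_of_multiset m" if "v \<in> Q_words S n" "mset v = m" for v
    using that by (auto simp: Q_words_def sorted_sort_id)
  then have "{v \<in> Q_words S n. monomial v m \<noteq> (0 :: int poly)} =
        {v. v = sorted_list_of_multiset m \<and> v \<in> Q_words S n}"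
    unfolding monomial_def by (metis (lifting) mset_sorted_list_of_multiset zero_neq_one)
  also have "\<dots> = (if sorted_list_of_multiset m \<in> Q_words S n
                 then {sorted_list_of_multiset m} else {})"
    by auto
  finally show ?thesis
    by (simp add: Q_def formal_sum_def monomial_def)
qed

text \<open>Fixing the content \<open>m\<close> fixes \<open>v\<close>. The permutation is recovered
  as the unique standardization of the image, and every word of content \<open>m\<close> arises from
  its own standardization.\<close>

lemma bij_betw_substitute:
  fixes m :: "nat multiset"
  defines "v \<equiv> sorted_list_of_multiset m"
  shows "bij_betw (\<lambda>(\<sigma>, \<alpha>). (substitute v \<sigma>, \<alpha>))
    {(\<sigma>, \<alpha>) \<in> SW_perm n k l. v \<in> Q_words (Split \<sigma> \<alpha>) n} {(w, \<alpha>) \<in> SW n k l. mset w = m}"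
    (is "bij_betw ?f ?P ?W")
    and "\<And>\<sigma> \<alpha>. (\<sigma>, \<alpha>) \<in> SW_perm n k l \<Longrightarrow> v \<in> Q_words (Split \<sigma> \<alpha>) n \<Longrightarrow>
      sminv (substitute v \<sigma>) \<alpha> = sminv \<sigma> \<alpha>"
proof -
  have P: "length \<sigma> = n" "length (substitute v \<sigma>) = n" "composition n \<alpha>"
      "standardizes (tie (substitute v \<sigma>) \<alpha>) (substitute v \<sigma>) \<sigma>"
      "block_adj_distinct (substitute v \<sigma>) \<alpha>"
      "mset (substitute v \<sigma>) = m" "\<forall>a\<in>set (substitute v \<sigma>). 0 < a"
    if "(\<sigma>, \<alpha>) \<in> SW_perm n k l" "v \<in> Q_words (Split \<sigma> \<alpha>) n" for \<sigma> \<alpha>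
  proof -
    have perm: "length \<sigma> = n" "distinct \<sigma>" "set \<sigma> = {1..n}" "composition n \<alpha>"
      using that(1) by (auto simp: SW_perm_def SW_iff)
    have len: "length v = n"
      using that(2) by (simp add: Q_words_def)
    show "length \<sigma> = n" "length (substitute v \<sigma>) = n" "composition n \<alpha>"
      using perm by (simp_all add: substitute_def)
    show "standardizes (tie (substitute v \<sigma>) \<alpha>) (substitute v \<sigma>) \<sigma>"
      "block_adj_distinct (substitute v \<sigma>) \<alpha>"
      using substitute_standardizes[of \<sigma> v \<alpha>] perm that(2) by simp_all
    have "mset (substitute v \<sigma>) = mset v"
      using perm len by (intro mset_substitute) auto
    then show "mset (substitute v \<sigma>) = m" "\<forall>a\<in>set (substitute v \<sigma>). 0 < a"
      using that(2) mset_eq_setD[of "substitute v \<sigma>" v]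
      by (auto simp: v_def Q_words_def Suc_le_eq)
  qed
  show "sminv (substitute v \<sigma>) \<alpha> = sminv \<sigma> \<alpha>"
    if "(\<sigma>, \<alpha>) \<in> SW_perm n k l" "v \<in> Q_words (Split \<sigma> \<alpha>) n" for \<sigma> \<alpha>
    using standardizes_sminversion_iff[OF P(4)[OF that] _ P(5)[OF that]] P(2,3)[OF that]
    by (simp add: sminv_def)
  show "bij_betw ?f ?P ?W"
    unfolding bij_betw_def
  proof (intro conjI inj_onI set_eqI iffI)
    fix x y assume "x \<in> ?P" "y \<in> ?P" "?f x = ?f y"
    then show "x = y"
      using P(4) standardizes_unique by (auto split: prod.splits) metis
  next
    fix x assume "x \<in> ?f ` ?P"
    then obtain \<sigma> \<alpha> where x: "x = (substitute v \<sigma>, \<alpha>)"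
      and \<sigma>: "(\<sigma>, \<alpha>) \<in> SW_perm n k l" "v \<in> Q_words (Split \<sigma> \<alpha>) n"
      by auto
    show "x \<in> ?W"
      using x \<sigma>(1) standardizes_SW_iff[OF P(4)[OF \<sigma>] _ P(5)[OF \<sigma>] P(7)[OF \<sigma>], of k l]
        P(2,3,6)[OF \<sigma>] by simp
  next
    fix x assume "x \<in> ?W"
    then obtain w \<alpha> where x: "x = (w, \<alpha>)" and w: "(w, \<alpha>) \<in> SW n k l" and m: "mset w = m"
      by auto
    have *: "length w = n" "composition (length w) \<alpha>" "\<forall>a\<in>set w. 0 < a" "block_adj_distinct w \<alpha>"
      using w by (auto simp: SW_iff)
    obtain \<sigma> where std: "standardizes (tie w \<alpha>) w \<sigma>"
      using standardizes_exists[of "tie w \<alpha>"] by (auto simp: inj_def tie_eq_iff)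
    have "v = sort w"
      using m by (auto simp: v_def)
    then have "v \<in> Q_words (Split \<sigma> \<alpha>) n" "substitute v \<sigma> = w"
      using sort_in_Q_words[OF std *(2,4,3)] standardizes_substitute_sort[OF std] *(1) by simp_all
    moreover have "(\<sigma>, \<alpha>) \<in> SW_perm n k l"
      using standardizes_SW_iff[OF std *(2,4,3)] w *(1) by simp
    ultimately show "x \<in> ?f ` ?P"
      using x by force
  qed
qed

theorem proposition5p3:
  fixes n k l :: nat
  assumes "n \<ge> 1" and "k + l < n"
  shows "formal_sum (\<lambda>(w, \<alpha>). scale (q ^ sminv w \<alpha>) (monomial w)) (SW n k l)
       = formal_sum (\<lambda>(\<sigma>, \<alpha>). scale (q ^ sminv \<sigma> \<alpha>) (Q (Split \<sigma> \<alpha>) n)) (SW_perm n k l)"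
proof
  fix m :: "nat multiset"
  let ?v = "sorted_list_of_multiset m"
  let ?W = "{(w, \<alpha>) \<in> SW n k l. mset w = m}"
  let ?P = "{(\<sigma>, \<alpha>) \<in> SW_perm n k l. ?v \<in> Q_words (Split \<sigma> \<alpha>) n}"
  \<comment> \<open>Powers of \<open>q\<close> do not vanish, so the supports over which
    \<open>formal_sum\<close> adds are exactly \<open>?W\<close> and \<open>?P\<close>.\<close>
  have q: "q \<noteq> 0"
    by (simp add: q_def)
  have "formal_sum (\<lambda>(w, \<alpha>). scale (q ^ sminv w \<alpha>) (monomial w)) (SW n k l) m =
        (\<Sum>(w, \<alpha>)\<in>?W. q ^ sminv w \<alpha>)"
    unfolding formal_sum_def
    by (rule sum.cong) (auto simp: scale_def monomial_def q split: if_splits)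
  also have "\<dots> = (\<Sum>(\<sigma>, \<alpha>)\<in>?P. q ^ sminv (substitute ?v \<sigma>) \<alpha>)"
    using sum.reindex_bij_betw[OF bij_betw_substitute(1)[where m = m and n = n and k = k and l = l],
        of "\<lambda>(w, \<alpha>). q ^ sminv w \<alpha>"]
    by (simp add: case_prod_unfold)
  also have "\<dots> = (\<Sum>(\<sigma>, \<alpha>)\<in>?P. q ^ sminv \<sigma> \<alpha>)"
    by (rule sum.cong) (auto simp: bij_betw_substitute(2))
  also have "\<dots> = formal_sum (\<lambda>(\<sigma>, \<alpha>). scale (q ^ sminv \<sigma> \<alpha>) (Q (Split \<sigma> \<alpha>) n)) (SW_perm n k l) m"
    unfolding formal_sum_def
    by (rule sum.cong) (auto simp: scale_def Q_coeff q split: if_splits)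
  finally show "formal_sum (\<lambda>(w, \<alpha>). scale (q ^ sminv w \<alpha>) (monomial w)) (SW n k l) m =
    formal_sum (\<lambda>(\<sigma>, \<alpha>). scale (q ^ sminv \<sigma> \<alpha>) (Q (Split \<sigma> \<alpha>) n)) (SW_perm n k l) m" .
qed

end
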